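(* Let $(X,Y)$ be a pair of non-negative integer-valued random variables defined on the same probability space, and let $\mu_X,\mu_Y\ge0$. Suppose that, for every $p,q\in[0,1]$, the random variable $X_p+Y_q$ has a Poisson distribution with mean $p\mu_X+q\mu_Y$. Then $X$ and $Y$ are independent Poisson random variables with means $\mu_X$ and $\mu_Y$, respectively.
   Context: For $p,q\in[0,1]$, $X_p$ and $Y_q$ denote the thinned versions of $X$ and $Y$: conditionally on $(X,Y)$, the variables $X_p$ and $Y_q$ are independent, $X_p$ is binomial with parameters $X$ and $p$, and $Y_q$ is binomial with parameters $Y$ and $q$. The Poisson distribution with mean $0$ is the point mass at $0$. *)

theory Defs
  imports "HOL-Probability.Probability"
begin

(* poisson_pmf is only specified for a positive rate; a mean of 0 stands for the point mass at 0. *)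
definition poisson_law :: "real \<Rightarrow> nat pmf" where
  "poisson_law m = (if m = 0 then return_pmf 0 else poisson_pmf m)"

(* The joint law of the thinned variables (X_p, Y_q): the mixture over the sample point of the
   product of the binomial laws with parameters (X, p) and (Y, q).  This is what conditional
   independence given (X, Y) with binomial conditional laws means; the law does not depend on
   the extension of M on which X_p and Y_q are realised.  Meaningful for measurable X and Y and
   for p, q in [0, 1]. *)
definition thinned_pair_law ::
  "'a measure \<Rightarrow> ('a \<Rightarrow> nat) \<Rightarrow> ('a \<Rightarrow> nat) \<Rightarrow> real \<Rightarrow> real \<Rightarrow> (nat \<times> nat) measure" where
  "thinned_pair_law M X Y p q =
     M \<bind> (\<lambda>\<omega>. measure_pmf (pair_pmf (binomial_pmf (X \<omega>) p) (binomial_pmf (Y \<omega>) q)))"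

definition thinned_sum_law ::
  "'a measure \<Rightarrow> ('a \<Rightarrow> nat) \<Rightarrow> ('a \<Rightarrow> nat) \<Rightarrow> real \<Rightarrow> real \<Rightarrow> nat measure" where
  "thinned_sum_law M X Y p q =
     distr (thinned_pair_law M X Y p q) (count_space UNIV) (\<lambda>(i, j). i + j)"

lemma (in prob_space) emeasure_thinned_pair_law:
  fixes X Y :: "'a \<Rightarrow> nat"
  assumes [measurable]: "random_variable (count_space UNIV) X" "random_variable (count_space UNIV) Y"
    and "p \<in> {0..1}" "q \<in> {0..1}"
  shows "emeasure (thinned_pair_law M X Y p q) {(i, j)} =
    (\<integral>\<^sup>+\<omega>. ennreal (real (X \<omega> choose i) * p ^ i * (1 - p) ^ (X \<omega> - i) *
       (real (Y \<omega> choose j) * q ^ j * (1 - q) ^ (Y \<omega> - j))) \<partial>M)"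
proof -
  have [measurable]: "(\<lambda>\<omega>. (X \<omega>, Y \<omega>)) \<in> measurable M (count_space UNIV)"
    using measurable_Pair[OF assms(1,2)]
    by (simp add: pair_measure_countable[of UNIV UNIV])
  have "(\<lambda>\<omega>. (\<lambda>(x, y). measure_pmf (pair_pmf (binomial_pmf x p) (binomial_pmf y q))) (X \<omega>, Y \<omega>))
      \<in> measurable M (subprob_algebra (count_space UNIV))"
    by (rule measurable_compose[where N = "count_space UNIV"])
      (auto simp: measurable_count_space_eq1 intro!: measure_pmf_in_subprob_algebra)
  then have "(\<lambda>\<omega>. measure_pmf (pair_pmf (binomial_pmf (X \<omega>) p) (binomial_pmf (Y \<omega>) q)))
      \<in> measurable M (subprob_algebra (count_space UNIV))"
    by simp
  from emeasure_bind[OF not_empty this, of "{(i, j)}"] show ?thesis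
    unfolding thinned_pair_law_def using assms(3,4)
    by (simp add: emeasure_pmf_single pmf_pair)
qed

end

theory Submission
  imports Defs "HOL-Complex_Analysis.Cauchy_Integral_Formula"
begin

text \<open>The event \<open>X\<^sub>p + Y\<^sub>q = 0\<close> has probability \<open>E ((1 - p)\<^sup>X (1 - q)\<^sup>Y)\<close>. The hypothesis
  evaluates it as \<open>exp (- p \<mu>\<^sub>X - q \<mu>\<^sub>Y)\<close>, so the joint probability generating function of \<open>(X, Y)\<close>
  on the unit square is that of a pair of independent Poisson variables, and a joint generating
  function determines the law.\<close>

text \<open>Finite sums at \<open>x = 1\<close> make all coefficients finite, so the difference is a
  real power series converging on the open unit disc. It vanishes on \<open>{0..1}\<close>, which
  accumulates at 0, while a power series with a nonzero coefficient has isolated zeros. Working in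
  \<open>ennreal\<close> lets the coefficients themselves be infinite sums or measures.\<close>

lemma ennreal_powser_unique:
  fixes c d :: "nat \<Rightarrow> ennreal"
  assumes c: "(\<Sum>i. c i) < \<top>" and d: "(\<Sum>i. d i) < \<top>"
    and eq: "\<And>x. x \<in> {0..1} \<Longrightarrow> (\<Sum>i. c i * ennreal (x ^ i)) = (\<Sum>i. d i * ennreal (x ^ i))"
  shows "c = d"
proof -
  define a b where "a = (\<lambda>i. enn2real (c i))" and "b = (\<lambda>i. enn2real (d i))"
  have "c i < \<top>" "d i < \<top>" for i
    using ennreal_suminf_lessD[OF c] ennreal_suminf_lessD[OF d] by auto
  then have ca: "c = (\<lambda>i. ennreal (a i))" and db: "d = (\<lambda>i. ennreal (b i))"
    by (auto simp: a_def b_def)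
  have nonneg: "a i \<ge> 0" "b i \<ge> 0" for i
    by (auto simp: a_def b_def)
  have sum1: "summable a" "summable b"
    using c d nonneg unfolding ca db by (metis summable_suminf_not_top less_irrefl)+
  have sumx: "summable (\<lambda>i. f i * x ^ i)"
    if "summable f" "\<And>i. f i \<ge> 0" "x \<in> {0..1}" for f :: "nat \<Rightarrow> real" and x
    using that by (intro summable_comparison_test'[OF that(1), of 0])
      (auto simp: abs_mult intro!: mult_left_le power_le_one)
  have real_eq: "(\<Sum>i. a i * x ^ i) = (\<Sum>i. b i * x ^ i)" if x: "x \<in> {0..1}" for x
  proof -
    have "ennreal (\<Sum>i. a i * x ^ i) = ennreal (\<Sum>i. b i * x ^ i)"
      using eq[OF x] x nonneg sumx[OF sum1(1) _ x] sumx[OF sum1(2) _ x]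
      by (simp add: ca db suminf_ennreal2 flip: ennreal_mult)
    then show ?thesis
      using x nonneg sumx[OF sum1(1) _ x] sumx[OF sum1(2) _ x]
      by (subst (asm) ennreal_inj) (auto intro!: suminf_nonneg)
  qed
  have "a i - b i = 0" for i
  proof (rule ccontr)
    define f where "f = (\<lambda>x. \<Sum>i. (a i - b i) * x ^ i)"
    assume ne: "a i - b i \<noteq> 0"
    have sm: "summable (\<lambda>i. (a i - b i) * x ^ i)" if "norm x < 1" for x
      using powser_inside[of "\<lambda>i. a i - b i" 1 x] that summable_diff[OF sum1] by simp
    have zero: "f x = 0" if x: "x \<in> {0..1}" for x
      using suminf_diff[OF sumx[OF sum1(1) _ x] sumx[OF sum1(2) _ x]] nonneg real_eq[OF x]
      by (simp add: f_def algebra_simps)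
    \<comment> \<open>Isolation of the zero at 0 is obtained from \<open>powser_0_nonzero\<close>,
      which asks for a nonzero coefficient of positive index; evaluating at 0 rules out index
      0.\<close>
    have "a 0 - b 0 = 0"
      using real_eq[of 0] by (simp add: powser_zero)
    then have "i > 0"
      using ne by (cases i) auto
    moreover have "(\<lambda>i. (a i - b i) * (x - 0) ^ i) sums f x" if "norm (x - 0) < 1" for x
      using sm[of x] that by (simp add: f_def summable_sums)
    moreover have "f 0 = 0"
      by (rule zero) simp
    ultimately obtain s where s: "s > 0" "\<And>z. z \<in> cball 0 s - {0} \<Longrightarrow> f z \<noteq> 0"
      using ne powser_0_nonzero[of 1 0 "\<lambda>i. a i - b i" f i] by auto
    \<comment> \<open>The point \<open>min s 1\<close> lies both in the punctured ball where
      \<open>f\<close> has no zero and in \<open>{0..1}\<close> where \<open>f\<close>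
      vanishes.\<close>
    show False
      using s(2)[of "min s 1"] zero[of "min s 1"] s(1) by (cases "s \<le> 1") auto
  qed
  then show ?thesis
    by (simp add: ca db)
qed

text \<open>The generating function is a power series in \<open>u\<close> whose coefficients are
  power series in \<open>v\<close>. Uniqueness is applied first in \<open>u\<close> with
  \<open>v\<close> fixed, then in \<open>v\<close> for each row \<open>i\<close>, giving equal
  masses of all singletons.\<close>

lemma measure_eqI_pgf2:
  fixes P Q :: "(nat \<times> nat) measure"
  assumes P: "finite_measure P" "sets P = UNIV" and Q: "finite_measure Q" "sets Q = UNIV"
    and eq: "\<And>u v. u \<in> {0..1} \<Longrightarrow> v \<in> {0..1} \<Longrightarrow>
      (\<integral>\<^sup>+(i, j). ennreal (u ^ i * v ^ j) \<partial>P) = (\<integral>\<^sup>+(i, j). ennreal (u ^ i * v ^ j) \<partial>Q)"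
  shows "P = Q"
proof -
  define S where "S N u v = (\<Sum>i. (\<Sum>j. emeasure N {(i, j)} * ennreal (v ^ j)) * ennreal (u ^ i))"
    for N :: "(nat \<times> nat) measure" and u v :: real
  have S: "(\<integral>\<^sup>+(i, j). ennreal (u ^ i * v ^ j) \<partial>N) = S N u v"
    if N: "sets N = UNIV" and uv: "u \<in> {0..1}" "v \<in> {0..1}" for N u v
  proof -
    have "N = density (count_space UNIV) (\<lambda>x. emeasure N {x})"
      using N by (intro measure_eqI_countable[of _ UNIV])
        (simp_all add: emeasure_density nn_integral_indicator_singleton)
    then have "(\<integral>\<^sup>+(i, j). ennreal (u ^ i * v ^ j) \<partial>N) =
        (\<integral>\<^sup>+x. (case x of (i, j) \<Rightarrow> ennreal (u ^ i * v ^ j))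
           \<partial>density (count_space UNIV) (\<lambda>x. emeasure N {x}))"
      by simp
    also have "\<dots> = (\<integral>\<^sup>+x. emeasure N {x} * (case x of (i, j) \<Rightarrow> ennreal (u ^ i * v ^ j)) \<partial>count_space UNIV)"
      by (subst nn_integral_density) auto
    also have "\<dots> = (\<Sum>i. \<Sum>j. emeasure N {(i, j)} * ennreal (u ^ i * v ^ j))"
      by (simp add: nn_integral_fst_count_space[symmetric] nn_integral_count_space_nat)
    also have "\<dots> = S N u v"
      unfolding S_def ennreal_suminf_multc[symmetric]
      using uv by (intro suminf_cong) (simp add: ennreal_mult mult_ac)
    finally show ?thesis .
  qed
  \<comment> \<open>At \<open>u = 1\<close> the outer series is the sum of its coefficients, bounded
    by the total mass; this is the finiteness that uniqueness in \<open>u\<close> demands.\<close>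
  have fin: "S N 1 v < \<top>" if N: "finite_measure N" "sets N = UNIV" and v: "v \<in> {0..1}" for N v
  proof -
    have "S N 1 v = (\<integral>\<^sup>+(i, j). ennreal (1 ^ i * v ^ j) \<partial>N)"
      using S[OF N(2) _ v, of 1] by simp
    also have "\<dots> \<le> (\<integral>\<^sup>+x. 1 \<partial>N)"
      using v by (intro nn_integral_mono) (auto intro!: power_le_one)
    also have "\<dots> < \<top>"
      using finite_measure.emeasure_finite[OF N(1), of "space N"] by (simp add: less_top)
    finally show ?thesis .
  qed
  have rows: "(\<Sum>j. emeasure P {(i, j)} * ennreal (v ^ j)) = (\<Sum>j. emeasure Q {(i, j)} * ennreal (v ^ j))"
    if v: "v \<in> {0..1}" for i v
  proof -
    have "(\<lambda>i. \<Sum>j. emeasure P {(i, j)} * ennreal (v ^ j)) =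
        (\<lambda>i. \<Sum>j. emeasure Q {(i, j)} * ennreal (v ^ j))"
    proof (rule ennreal_powser_unique)
      fix u :: real assume "u \<in> {0..1}"
      then show "(\<Sum>i. (\<Sum>j. emeasure P {(i, j)} * ennreal (v ^ j)) * ennreal (u ^ i)) =
          (\<Sum>i. (\<Sum>j. emeasure Q {(i, j)} * ennreal (v ^ j)) * ennreal (u ^ i))"
        using eq[of u v] S[OF P(2), of u v] S[OF Q(2), of u v] v by (simp add: S_def)
    qed (use fin[OF P v] fin[OF Q v] in \<open>simp_all add: S_def\<close>)
    then show ?thesis
      by (rule fun_cong)
  qed
  \<comment> \<open>Taking \<open>v = 1\<close> as well bounds each row by the total mass, as needed
    for uniqueness in \<open>v\<close>.\<close>
  have rowfin: "(\<Sum>j. emeasure N {(i, j)}) < \<top>"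
    if "finite_measure N" "sets N = UNIV" for N and i :: nat
    using fin[OF that, of 1] by (auto simp: S_def dest: ennreal_suminf_lessD)
  have "(\<lambda>j. emeasure P {(i, j)}) = (\<lambda>j. emeasure Q {(i, j)})" for i
    by (rule ennreal_powser_unique) (use rows rowfin[OF P] rowfin[OF Q] in auto)
  then show ?thesis
    using P Q by (intro measure_eqI_countable[of _ UNIV]) (auto simp: fun_eq_iff)
qed

text \<open>Because \<open>0 ^ 0 = 1\<close>, the usual formula also covers the point mass at
  \<open>m = 0\<close>, so later steps need no case split on the mean.\<close>

lemma pmf_poisson_law:
  assumes "m \<ge> 0"
  shows "pmf (poisson_law m) k = m ^ k / fact k * exp (- m)"
  using assms by (cases k) (auto simp: poisson_law_def pmf_return)

text \<open>This is the exponential series at \<open>u * m\<close>. The exponent is arranged to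
  match the probability of 0 under thinning with parameter \<open>1 - u\<close>.\<close>

lemma poisson_law_pgf:
  assumes m: "m \<ge> 0" and u: "u \<ge> 0"
  shows "(\<integral>\<^sup>+i. ennreal (u ^ i) \<partial>poisson_law m) = ennreal (exp (- ((1 - u) * m)))"
proof -
  have "(\<lambda>i. (u * m) ^ i /\<^sub>R fact i * exp (- m)) sums (exp (u * m) * exp (- m))"
    by (intro sums_mult2 exp_converges)
  then have "(\<lambda>i. pmf (poisson_law m) i * u ^ i) sums (exp (u * m) * exp (- m))"
    using m by (simp add: pmf_poisson_law power_mult_distrib field_simps)
  then have "(\<Sum>i. ennreal (pmf (poisson_law m) i * u ^ i)) = ennreal (exp (u * m) * exp (- m))"
    using u by (intro suminf_ennreal_eq) auto
  then show ?thesis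
    using u by (simp add: nn_integral_measure_pmf nn_integral_count_space_nat algebra_simps
      flip: ennreal_mult exp_add)
qed

text \<open>A sum of naturals is 0 only at \<open>(0, 0)\<close>, where the binomial weights reduce
  to powers of \<open>1 - p\<close> and \<open>1 - q\<close>.\<close>

lemma (in prob_space) emeasure_thinned_sum_law_0:
  fixes X Y :: "'a \<Rightarrow> nat"
  assumes X: "random_variable (count_space UNIV) X" and Y: "random_variable (count_space UNIV) Y"
    and p: "p \<in> {0..1}" and q: "q \<in> {0..1}"
  shows "emeasure (thinned_sum_law M X Y p q) {0} =
    (\<integral>\<^sup>+\<omega>. ennreal ((1 - p) ^ X \<omega> * (1 - q) ^ Y \<omega>) \<partial>M)"
proof -
  have sets: "sets (thinned_pair_law M X Y p q) = UNIV"
    unfolding thinned_pair_law_def by (subst sets_bind[of _ _ "count_space UNIV"]) (auto simp: not_empty)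
  then have "space (thinned_pair_law M X Y p q) = UNIV"
    using sets_eq_imp_space_eq[of _ "count_space UNIV"] by auto
  then have "emeasure (thinned_sum_law M X Y p q) {0} = emeasure (thinned_pair_law M X Y p q) {(0, 0)}"
    unfolding thinned_sum_law_def using sets
    by (subst emeasure_distr) (auto simp: measurable_def intro!: arg_cong[where f = "emeasure _"])
  then show ?thesis
    by (simp add: emeasure_thinned_pair_law[OF X Y p q])
qed

text \<open>On countable types the product sigma-algebra is discrete, so comparing singletons
  suffices. This links independence, phrased with product measures, to
  \<open>pair_pmf\<close>.\<close>

lemma pair_measure_pmf:
  fixes A :: "'a :: countable pmf" and B :: "'b :: countable pmf"
  shows "measure_pmf A \<Otimes>\<^sub>M measure_pmf B = measure_pmf (pair_pmf A B)"
proof (rule measure_eqI_countable[of _ UNIV])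
  have "sets (measure_pmf A \<Otimes>\<^sub>M measure_pmf B) = sets (count_space UNIV \<Otimes>\<^sub>M count_space UNIV)"
    by (intro sets_pair_measure_cong) auto
  then show "sets (measure_pmf A \<Otimes>\<^sub>M measure_pmf B) = Pow UNIV"
    by (subst (asm) pair_measure_countable) simp_all
  show "emeasure (measure_pmf A \<Otimes>\<^sub>M measure_pmf B) {x} = emeasure (pair_pmf A B) {x}" for x
  proof (cases x)
    case (Pair i j)
    have "emeasure (measure_pmf A \<Otimes>\<^sub>M measure_pmf B) ({i} \<times> {j}) = emeasure A {i} * emeasure B {j}"
      by (rule measure_pmf.emeasure_pair_measure_Times) auto
    then show ?thesis
      by (simp add: Pair emeasure_pmf_single pmf_pair ennreal_mult)
  qed
qed auto

theorem theorem2p1: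
  fixes M :: "'a measure" and X Y :: "'a \<Rightarrow> nat" and \<mu>X \<mu>Y :: real
  assumes "prob_space M"
    and "X \<in> measurable M (count_space UNIV)"
    and "Y \<in> measurable M (count_space UNIV)"
    and "\<mu>X \<ge> 0" and "\<mu>Y \<ge> 0"
    and "\<And>p q. p \<in> {0..1} \<Longrightarrow> q \<in> {0..1} \<Longrightarrow>
           thinned_sum_law M X Y p q = measure_pmf (poisson_law (p * \<mu>X + q * \<mu>Y))"
  shows "prob_space.indep_var M (count_space UNIV) X (count_space UNIV) Y \<and>
         distr M (count_space UNIV) X = measure_pmf (poisson_law \<mu>X) \<and>
         distr M (count_space UNIV) Y = measure_pmf (poisson_law \<mu>Y)"
proof -
  interpret prob_space M by fact
  note X[measurable] = assms(2) and Y[measurable] = assms(3)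
  define J where "J = distr M (count_space UNIV) (\<lambda>\<omega>. (X \<omega>, Y \<omega>))"
  define Q where "Q = pair_pmf (poisson_law \<mu>X) (poisson_law \<mu>Y)"
  have XY[measurable]: "(\<lambda>\<omega>. (X \<omega>, Y \<omega>)) \<in> measurable M (count_space UNIV)"
    using measurable_Pair[OF X Y] by (simp add: pair_measure_countable)
  have joint: "J = measure_pmf Q"
  proof (rule measure_eqI_pgf2)
    show "finite_measure J"
      unfolding J_def by (rule finite_measure_distr) fact
    fix u v :: real assume u: "u \<in> {0..1}" and v: "v \<in> {0..1}"
    have "(\<integral>\<^sup>+(i, j). ennreal (u ^ i * v ^ j) \<partial>J) = (\<integral>\<^sup>+\<omega>. ennreal (u ^ X \<omega> * v ^ Y \<omega>) \<partial>M)"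
      unfolding J_def by (subst nn_integral_distr) auto
    \<comment> \<open>Thinning with \<open>p = 1 - u\<close> and \<open>q = 1 - v\<close> turns the
      generating function at \<open>(u, v)\<close> into a probability of 0; the whole unit square is
      reached this way.\<close>
    also have "\<dots> = emeasure (thinned_sum_law M X Y (1 - u) (1 - v)) {0}"
      using u v by (subst emeasure_thinned_sum_law_0) auto
    also have "\<dots> = ennreal (exp (- ((1 - u) * \<mu>X)) * exp (- ((1 - v) * \<mu>Y)))"
      using u v assms(4,5)
      by (simp add: assms(6) emeasure_pmf_single pmf_poisson_law flip: exp_add)
    also have "\<dots> = (\<integral>\<^sup>+(i, j). ennreal (u ^ i * v ^ j) \<partial>Q)"
      using u v assms(4,5)
      by (simp add: Q_def nn_integral_pair_pmf' ennreal_mult nn_integral_cmult nn_integral_multc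
        poisson_law_pgf)
    finally show "(\<integral>\<^sup>+(i, j). ennreal (u ^ i * v ^ j) \<partial>J) = (\<integral>\<^sup>+(i, j). ennreal (u ^ i * v ^ j) \<partial>Q)" .
  qed (auto simp: J_def measure_pmf.finite_measure_axioms)
  have "distr M (count_space UNIV) X = distr J (count_space UNIV) fst"
    unfolding J_def by (subst distr_distr) (auto simp: comp_def)
  also have "\<dots> = measure_pmf (poisson_law \<mu>X)"
    by (simp add: joint Q_def map_fst_pair_pmf flip: map_pmf_rep_eq)
  finally have lawX: "distr M (count_space UNIV) X = measure_pmf (poisson_law \<mu>X)" .
  have "distr M (count_space UNIV) Y = distr J (count_space UNIV) snd"
    unfolding J_def by (subst distr_distr) (auto simp: comp_def)
  also have "\<dots> = measure_pmf (poisson_law \<mu>Y)"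
    by (simp add: joint Q_def map_snd_pair_pmf flip: map_pmf_rep_eq)
  finally have lawY: "distr M (count_space UNIV) Y = measure_pmf (poisson_law \<mu>Y)" .
  \<comment> \<open>Independence means that the joint law is the product of the marginals, so both
    marginals are first read off from \<open>Q\<close>.\<close>
  have "indep_var (count_space UNIV) X (count_space UNIV) Y"
    using joint by (simp add: indep_var_distribution_eq lawX lawY pair_measure_pmf
      pair_measure_countable J_def Q_def)
  with lawX lawY show ?thesis
    by simp
qed

end
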